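(* Let $X$ be a Dedekind complete weakly $\sigma$-distributive Riesz space, let $\mathbb{T}$ be a time scale and let $a,b\in\mathbb{T}$ with $a<b$. Let $f:[a,b]_{\mathbb{T}}\to X$ and let $\{f_n\}_{n=1}^{\infty}$ be a sequence of functions $f_n:[a,b]_{\mathbb{T}}\to X$ that is uniformly HK $\Delta$-integrable on $[a,b]_{\mathbb{T}}$. Assume that $f_n\to f$ with a common regulating sequence. Then $f$ is HK $\Delta$-integrable on $[a,b]_{\mathbb{T}}$ and $$\lim_{n\to\infty}\int_a^b f_n(t)\,\Delta t=\int_a^b f(t)\,\Delta t .$$
   Context: Riesz spaces. A sequence $(b_n)_n$ in a Riesz space $X$ is an $(o)$-sequence if it is decreasing and $\bigwedge_n b_n=0$. An (order) bounded double sequence $(a_{i,j})_{i,j\in\mathbb{N}}$ in $X$ is a $(D)$-sequence (regulator) if for every $i\in\mathbb{N}$ the sequence $(a_{i,j})_{j}$ is an $(o)$-sequence. $X$ is Dedekind complete if every nonempty subset bounded from above has a supremum. A Dedekind complete $X$ is weakly $\sigma$-distributive if $\bigwedge_{\varphi\in\mathbb{N}^{\mathbb{N}}}\big(\bigvee_{i=1}^{\infty}a_{i,\varphi(i)}\big)=0$ for every $(D)$-sequence $(a_{i,j})_{i,j}$. In $X$, $u<v$ means $u\le v$ and $u\neq v$. Time scales. A time scale $\mathbb{T}$ is a nonempty closed subset of $\mathbb{R}$; $[a,b]_{\mathbb{T}}=\{t\in\mathbb{T}:a\le t\le b\}$, and similarly for the other types of intervals. $\sigma(t)=\inf\{s\in\mathbb{T}:s>t\}$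 (with $\inf\emptyset=\sup\mathbb{T}$) and $\mu(t)=\sigma(t)-t$. Gauges and partitions. A $\Delta$-gauge for $[a,b]_{\mathbb{T}}$ is a pair $\delta=(\delta_L,\delta_R)$ of real-valued functions on $[a,b]_{\mathbb{T}}$ with $\delta_L>0$ on $(a,b]_{\mathbb{T}}$, $\delta_R>0$ on $[a,b)_{\mathbb{T}}$, $\delta_L(a)\ge 0$, $\delta_R(b)\ge 0$, and $\delta_R(\xi)\ge\mu(\xi)$ for all $\xi\in[a,b)_{\mathbb{T}}$. A $\delta$-fine HK partition of $[a,b]_{\mathbb{T}}$ is a finite collection $\mathcal{D}=\{([t_{i-1},t_i]_{\mathbb{T}},\xi_i)\}_{i=1}^n$ with $t_i\in\mathbb{T}$, $a=t_0<t_1<\dots<t_n=b$, and $\xi_i\in[t_{i-1},t_i]_{\mathbb{T}}\subset[\xi_i-\delta_L(\xi_i),\xi_i+\delta_R(\xi_i)]$ for all $i$. For $f:[a,b]_{\mathbb{T}}\to X$ put $S(f,\mathcal{D},\delta)=\sum_{i=1}^n f(\xi_i)(t_i-t_{i-1})$. Integral. $f:[a,b]_{\mathbb{T}}\to X$ is HK $\Delta$-integrable on $[a,b]_{\mathbb{T}}$ if there exist $x\in X$ and a $(D)$-sequence $(a_{i,j})_{i,j}$ in $X$ such that for every $\varphi\in\mathbb{N}^{\mathbb{N}}$ there is a $\Delta$-gauge $\delta$ for $[a,b]_{\mathbb{T}}$ with $|S(f,\mathcal{D},\delta)-x|<\bigvee_{i=1}^{\infty}a_{i,\varphi(i)}$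 for each $\delta$-fine HK partition $\mathcal{D}$ of $[a,b]_{\mathbb{T}}$. Such $x$ is unique and is denoted $\int_a^b f(t)\,\Delta t$. Convergence with a common regulating sequence. $f_n\to f$ with a common regulating sequence if there is a $(D)$-sequence $(a_{i,j})_{i,j}$ in $X$ such that for every $\varphi\in\mathbb{N}^{\mathbb{N}}$ and every $t\in[a,b]_{\mathbb{T}}$ there is $p=p(t)\in\mathbb{N}$ (possibly depending on $\varphi$) such that $|f_n(t)-f(t)|<\bigvee_{i=1}^{\infty}a_{i,\varphi(i)}$ for all $n\ge p$. Uniform integrability. $\{f_n\}$ is uniformly HK $\Delta$-integrable on $[a,b]_{\mathbb{T}}$ if each $f_n$ is HK $\Delta$-integrable on $[a,b]_{\mathbb{T}}$ and there is a $(D)$-sequence $(b_{i,j})_{i,j}$ in $X$ such that for every $\varphi\in\mathbb{N}^{\mathbb{N}}$ there is a $\Delta$-gauge $\delta$ for $[a,b]_{\mathbb{T}}$ with $\big|S(f_n,\mathcal{D},\delta)-\int_a^b f_n(t)\Delta t\big|<\bigvee_{i=1}^{\infty}b_{i,\varphi(i)}$ for each $\delta$-fine HK partition $\mathcal{D}$ of $[a,b]_{\mathbb{T}}$ and all $n\in\mathbb{N}$. Limits in $X$. $\lim_{n\to\infty}x_n=x$ means: there is a $(D)$-sequence $(d_{i,j})_{i,j}$ in $X$ such that for every $\varphi\in\mathbb{N}^{\mathbb{N}}$ there is $n_0\in\mathbb{N}$ with $|x_n-x|\le\bigvee_{i=1}^{\infty}d_{i,\varphi(i)}$ for all $n\ge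 n_0$. *)

theory Defs
  imports Complex_Main "HOL-Library.Lattice_Algebras"
begin

section \<open>Riesz spaces\<close>

class dedekind_complete_riesz_space =
  ordered_real_vector + conditionally_complete_lattice + lattice_ab_group_add_abs

text \<open>
  \<^const>\<open>Sup\<close> and \<^const>\<open>Inf\<close> of a conditionally complete lattice are meaningful only for
  nonempty, suitably bounded sets. The explicit boundedness conjuncts in the next two definitions
  guarantee that every \<open>INF\<close> and \<open>SUP\<close> over a regulator is a genuine infimum or supremum.
\<close>

definition o_sequence :: "(nat \<Rightarrow> 'a::dedekind_complete_riesz_space) \<Rightarrow> bool" where
  "o_sequence b \<longleftrightarrow> decseq b \<and> bdd_below (range b) \<and> (INF n. b n) = 0"

definition D_sequence :: "(nat \<Rightarrow> nat \<Rightarrow> 'a::dedekind_complete_riesz_space) \<Rightarrow> bool" where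
  "D_sequence a \<longleftrightarrow>
     bdd_above (range (\<lambda>(i, j). a i j)) \<and> bdd_below (range (\<lambda>(i, j). a i j)) \<and>
     (\<forall>i. o_sequence (a i))"

definition weakly_sigma_distributive :: "'a::dedekind_complete_riesz_space itself \<Rightarrow> bool" where
  "weakly_sigma_distributive _ \<longleftrightarrow>
     (\<forall>a :: nat \<Rightarrow> nat \<Rightarrow> 'a. D_sequence a \<longrightarrow> (INF \<phi>. SUP i. a i (\<phi> i)) = 0)"

definition D_limit ::
    "(nat \<Rightarrow> 'a::dedekind_complete_riesz_space) \<Rightarrow> 'a \<Rightarrow> bool" where
  "D_limit X x \<longleftrightarrow>
     (\<exists>d. D_sequence d \<and>
       (\<forall>\<phi>. \<exists>n\<^sub>0. \<forall>n\<ge>n\<^sub>0. \<bar>X n - x\<bar> \<le> (SUP i. d i (\<phi> i))))"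

section \<open>Time scales\<close>

definition time_scale :: "real set \<Rightarrow> bool" where
  "time_scale T \<longleftrightarrow> T \<noteq> {} \<and> closed T"

definition forward_jump :: "real set \<Rightarrow> real \<Rightarrow> real" where
  "forward_jump T t = (if \<exists>s\<in>T. t < s then Inf {s \<in> T. t < s} else Sup T)"

definition graininess :: "real set \<Rightarrow> real \<Rightarrow> real" where
  "graininess T t = forward_jump T t - t"

section \<open>Gauges, partitions and Riemann sums\<close>

text \<open>
  Functions on a time scale interval are represented by total functions on \<^typ>\<open>real\<close>; all notions
  below depend only on their values on \<open>T \<inter> {a..b}\<close>.
\<close>

definition delta_gauge ::
    "real set \<Rightarrow> real \<Rightarrow> real \<Rightarrow> (real \<Rightarrow> real) \<times> (real \<Rightarrow> real) \<Rightarrow> bool" where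
  "delta_gauge T a b = (\<lambda>(\<delta>\<^sub>L, \<delta>\<^sub>R).
     (\<forall>\<xi>\<in>T \<inter> {a<..b}. \<delta>\<^sub>L \<xi> > 0) \<and>
     (\<forall>\<xi>\<in>T \<inter> {a..<b}. \<delta>\<^sub>R \<xi> > 0) \<and>
     \<delta>\<^sub>L a \<ge> 0 \<and> \<delta>\<^sub>R b \<ge> 0 \<and>
     (\<forall>\<xi>\<in>T \<inter> {a..<b}. \<delta>\<^sub>R \<xi> \<ge> graininess T \<xi>))"

text \<open>
  A triple \<open>(n, t, \<xi>)\<close> stands for the collection of pairs \<open>(T \<inter> {t (i - 1)..t i}, \<xi> i)\<close> with
  \<open>i = 1, ..., n\<close>. Values of \<open>t\<close> and \<open>\<xi>\<close> at other indices are irrelevant.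
\<close>

type_synonym tagged_partition = "nat \<times> (nat \<Rightarrow> real) \<times> (nat \<Rightarrow> real)"

definition fine_HK_partition ::
    "real set \<Rightarrow> real \<Rightarrow> real \<Rightarrow> (real \<Rightarrow> real) \<times> (real \<Rightarrow> real) \<Rightarrow> tagged_partition \<Rightarrow> bool" where
  "fine_HK_partition T a b = (\<lambda>(\<delta>\<^sub>L, \<delta>\<^sub>R) (n, t, \<xi>).
     (\<forall>i\<in>{0..n}. t i \<in> T) \<and> t 0 = a \<and> t n = b \<and>
     (\<forall>i\<in>{1..n}. t (i - 1) < t i \<and>
        \<xi> i \<in> T \<inter> {t (i - 1)..t i} \<and>
        T \<inter> {t (i - 1)..t i} \<subseteq> {\<xi> i - \<delta>\<^sub>L (\<xi> i)..\<xi> i + \<delta>\<^sub>R (\<xi> i)}))"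

definition riemann_sum :: "(real \<Rightarrow> 'a::real_vector) \<Rightarrow> tagged_partition \<Rightarrow> 'a" where
  "riemann_sum f = (\<lambda>(n, t, \<xi>). \<Sum>i=1..n. (t i - t (i - 1)) *\<^sub>R f (\<xi> i))"

section \<open>The Henstock--Kurzweil delta integral\<close>

definition has_HK_integral ::
    "real set \<Rightarrow> real \<Rightarrow> real \<Rightarrow> (real \<Rightarrow> 'a::dedekind_complete_riesz_space) \<Rightarrow> 'a \<Rightarrow> bool" where
  "has_HK_integral T a b f x \<longleftrightarrow>
     (\<exists>A. D_sequence A \<and>
       (\<forall>\<phi>. \<exists>\<delta>. delta_gauge T a b \<delta> \<and>
         (\<forall>P. fine_HK_partition T a b \<delta> P \<longrightarrow>
            \<bar>riemann_sum f P - x\<bar> < (SUP i. A i (\<phi> i)))))"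

definition HK_integrable ::
    "real set \<Rightarrow> real \<Rightarrow> real \<Rightarrow> (real \<Rightarrow> 'a::dedekind_complete_riesz_space) \<Rightarrow> bool" where
  "HK_integrable T a b f \<longleftrightarrow> (\<exists>x. has_HK_integral T a b f x)"

definition HK_integral ::
    "real set \<Rightarrow> real \<Rightarrow> real \<Rightarrow> (real \<Rightarrow> 'a::dedekind_complete_riesz_space) \<Rightarrow> 'a" where
  "HK_integral T a b f = (THE x. has_HK_integral T a b f x)"

definition uniformly_HK_integrable ::
    "real set \<Rightarrow> real \<Rightarrow> real \<Rightarrow> (nat \<Rightarrow> real \<Rightarrow> 'a::dedekind_complete_riesz_space) \<Rightarrow> bool" where
  "uniformly_HK_integrable T a b f \<longleftrightarrow>
     (\<forall>n. HK_integrable T a b (f n)) \<and>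
     (\<exists>B. D_sequence B \<and>
       (\<forall>\<phi>. \<exists>\<delta>. delta_gauge T a b \<delta> \<and>
         (\<forall>P. fine_HK_partition T a b \<delta> P \<longrightarrow>
           (\<forall>n. \<bar>riemann_sum (f n) P - HK_integral T a b (f n)\<bar> < (SUP i. B i (\<phi> i))))))"

definition converges_common_regulator ::
    "real set \<Rightarrow> real \<Rightarrow> real \<Rightarrow> (nat \<Rightarrow> real \<Rightarrow> 'a::dedekind_complete_riesz_space) \<Rightarrow>
     (real \<Rightarrow> 'a) \<Rightarrow> bool" where
  "converges_common_regulator T a b f g \<longleftrightarrow>
     (\<exists>A. D_sequence A \<and>
       (\<forall>\<phi>. \<forall>t\<in>T \<inter> {a..b}. \<exists>p. \<forall>n\<ge>p. \<bar>f n t - g t\<bar> < (SUP i. A i (\<phi> i))))"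

end

theory Submission
  imports Defs "HOL-Analysis.Elementary_Metric_Spaces"
begin

text \<open>
  For a gauge \<open>\<delta>\<close> witnessing uniform integrability and a single \<open>\<delta>\<close>-fine partition \<open>P\<close> (which exists by
  Cousin's lemma), pointwise convergence at the finitely many tags of \<open>P\<close> makes the Riemann sums over
  \<open>P\<close> close to each other, so the integrals form a Cauchy sequence with respect to a regulator. Such
  a sequence converges by Dedekind completeness. Its limit is the integral of the limit function,
  because for every \<open>\<delta>\<close>-fine \<open>P\<close> one may pass through \<open>S(f\<^sub>n, P)\<close> and \<open>\<integral>f\<^sub>n\<close> with \<open>n\<close> depending on \<open>P\<close>.
  The sum of two regulators dominates both of them along the same \<open>\<phi>\<close>, so one regulator suffices
  throughout. Weak distributivity only enters through the uniqueness of the integral.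
\<close>

section \<open>Regulators\<close>

text \<open>Replaces the conditional \<open>INF\<close> by the two defining properties of a greatest
  lower bound, so that later arguments carry no boundedness side conditions.\<close>

lemma o_sequence_iff:
  fixes b :: "nat \<Rightarrow> 'a::dedekind_complete_riesz_space"
  shows "o_sequence b \<longleftrightarrow> decseq b \<and> (\<forall>n. 0 \<le> b n) \<and> (\<forall>z. (\<forall>n. z \<le> b n) \<longrightarrow> z \<le> 0)"
proof
  assume "o_sequence b"
  then have b: "decseq b" "bdd_below (range b)" "(INF n. b n) = 0"
    by (auto simp: o_sequence_def)
  have "0 \<le> b n" for n
    using cINF_lower[OF b(2), of n] b(3) by simp
  moreover have "z \<le> 0" if "\<forall>n. z \<le> b n" for z
    using cINF_greatest[of UNIV z b] that b(3) by simp
  ultimately show "decseq b \<and> (\<forall>n. 0 \<le> b n) \<and> (\<forall>z. (\<forall>n. z \<le> b n) \<longrightarrow> z \<le> 0)"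
    using b(1) by blast
next
  assume *: "decseq b \<and> (\<forall>n. 0 \<le> b n) \<and> (\<forall>z. (\<forall>n. z \<le> b n) \<longrightarrow> z \<le> 0)"
  then have bdd: "bdd_below (range b)"
    by (auto intro: bdd_belowI)
  have "(INF n. b n) \<le> 0"
    using * cINF_lower[OF bdd] by blast
  moreover have "0 \<le> (INF n. b n)"
    using * by (intro cINF_greatest) auto
  ultimately show "o_sequence b"
    using * bdd by (simp add: o_sequence_def)
qed

text \<open>By monotonicity a lower bound of the diagonal sums \<open>b n + c n\<close> is also a
  lower bound of all \<open>b m + c n\<close> with independent indices: compare at
  \<open>max m n\<close>. The two infima can then be removed one after the other.\<close>

lemma o_sequence_add:
  fixes b c :: "nat \<Rightarrow> 'a::dedekind_complete_riesz_space"
  assumes "o_sequence b" "o_sequence c"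
  shows "o_sequence (\<lambda>n. b n + c n)"
  unfolding o_sequence_iff
proof (intro conjI allI impI)
  have b: "decseq b" "\<And>n. 0 \<le> b n" "\<And>z. (\<And>n. z \<le> b n) \<Longrightarrow> z \<le> 0"
    and c: "decseq c" "\<And>n. 0 \<le> c n" "\<And>z. (\<And>n. z \<le> c n) \<Longrightarrow> z \<le> 0"
    using assms unfolding o_sequence_iff by blast+
  show "decseq (\<lambda>n. b n + c n)"
    using b(1) c(1) by (auto simp: decseq_def intro: add_mono)
  show "0 \<le> b n + c n" for n
    using b(2) c(2) by simp
  fix z assume z: "\<forall>n. z \<le> b n + c n"
  have "z - b m \<le> 0" for m
  proof (rule c(3))
    fix n
    have "z \<le> b (max m n) + c (max m n)"
      using z by blast
    also have "\<dots> \<le> b m + c n"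
      using b(1) c(1) by (auto simp: decseq_def intro: add_mono)
    finally show "z - b m \<le> c n"
      by (simp add: algebra_simps)
  qed
  then show "z \<le> 0"
    by (intro b(3)) simp
qed

lemma o_sequence_scaleR:
  fixes b :: "nat \<Rightarrow> 'a::dedekind_complete_riesz_space"
  assumes "o_sequence b" "0 < r"
  shows "o_sequence (\<lambda>n. r *\<^sub>R b n)"
  unfolding o_sequence_iff
proof (intro conjI allI impI)
  have b: "decseq b" "\<And>n. 0 \<le> b n" "\<And>z. (\<And>n. z \<le> b n) \<Longrightarrow> z \<le> 0"
    using assms unfolding o_sequence_iff by blast+
  show "decseq (\<lambda>n. r *\<^sub>R b n)"
    using b(1) assms(2) by (auto simp: decseq_def intro!: scaleR_left_mono)
  show "0 \<le> r *\<^sub>R b n" for n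
    using b(2) assms(2) by (simp add: scaleR_nonneg_nonneg)
  fix z assume z: "\<forall>n. z \<le> r *\<^sub>R b n"
  have "inverse r *\<^sub>R z \<le> 0"
  proof (rule b(3))
    fix n
    have "inverse r *\<^sub>R z \<le> inverse r *\<^sub>R (r *\<^sub>R b n)"
      using z assms(2) by (intro scaleR_left_mono) auto
    then show "inverse r *\<^sub>R z \<le> b n"
      using assms(2) by simp
  qed
  then have "r *\<^sub>R (inverse r *\<^sub>R z) \<le> r *\<^sub>R 0"
    using assms(2) by (intro scaleR_left_mono) auto
  then show "z \<le> 0"
    using assms(2) by simp
qed

lemma D_sequence_iff:
  fixes A :: "nat \<Rightarrow> nat \<Rightarrow> 'a::dedekind_complete_riesz_space"
  shows "D_sequence A \<longleftrightarrow> (\<exists>u. \<forall>i j. A i j \<le> u) \<and> (\<forall>i. o_sequence (A i))"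
proof -
  have "bdd_below (range (\<lambda>(i, j). A i j))" if "\<forall>i. o_sequence (A i)"
    using that by (auto simp: o_sequence_iff intro!: bdd_belowI)
  then show ?thesis
    by (auto simp: D_sequence_def bdd_above_def)
qed

lemma D_sequence_nonneg: "D_sequence A \<Longrightarrow> 0 \<le> A i j"
  by (simp add: D_sequence_iff o_sequence_iff)

lemma D_sequence_add:
  assumes "D_sequence A" "D_sequence B"
  shows "D_sequence (\<lambda>i j. A i j + B i j)"
proof -
  obtain u v where "\<And>i j. A i j \<le> u" "\<And>i j. B i j \<le> v"
    using assms unfolding D_sequence_iff by blast
  then have "\<forall>i j. A i j + B i j \<le> u + v"
    by (simp add: add_mono)
  then show ?thesis
    using assms unfolding D_sequence_iff by (blast intro: o_sequence_add)
qed

lemma D_sequence_scaleR: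
  assumes "D_sequence A" "0 < r"
  shows "D_sequence (\<lambda>i j. r *\<^sub>R A i j)"
proof -
  obtain u where "\<And>i j. A i j \<le> u"
    using assms unfolding D_sequence_iff by blast
  then have "\<forall>i j. r *\<^sub>R A i j \<le> r *\<^sub>R u"
    using assms(2) by (simp add: scaleR_left_mono)
  then show ?thesis
    using assms unfolding D_sequence_iff by (blast intro: o_sequence_scaleR)
qed

lemma D_sequence_bdd_above: "D_sequence A \<Longrightarrow> bdd_above (range (\<lambda>i. A i (\<phi> i)))"
  unfolding D_sequence_iff by (force intro: bdd_aboveI)

lemma SUP_D_sequence_le_add:
  assumes A: "D_sequence A" and B: "D_sequence B"
  shows "(SUP i. A i (\<phi> i)) \<le> (SUP i. A i (\<phi> i) + B i (\<phi> i))"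
    and "(SUP i. B i (\<phi> i)) \<le> (SUP i. A i (\<phi> i) + B i (\<phi> i))"
proof -
  have "A i (\<phi> i) \<le> A i (\<phi> i) + B i (\<phi> i)" "B i (\<phi> i) \<le> A i (\<phi> i) + B i (\<phi> i)" for i
    using D_sequence_nonneg[OF A] D_sequence_nonneg[OF B] by simp_all
  then show "(SUP i. A i (\<phi> i)) \<le> (SUP i. A i (\<phi> i) + B i (\<phi> i))"
    and "(SUP i. B i (\<phi> i)) \<le> (SUP i. A i (\<phi> i) + B i (\<phi> i))"
    using D_sequence_bdd_above[OF D_sequence_add[OF A B], of \<phi>]
    by (intro cSUP_mono; blast)+
qed

text \<open>Dividing by \<open>r\<close> turns an upper bound of the scaled family into one of the
  original family. Constant factors in estimates can thus be absorbed into the regulator.\<close>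

lemma SUP_scaleR_D_sequence_ge:
  assumes "D_sequence A" "0 < r"
  shows "r *\<^sub>R (SUP i. A i (\<phi> i)) \<le> (SUP i. r *\<^sub>R A i (\<phi> i))"
proof -
  have "(SUP i. A i (\<phi> i)) \<le> inverse r *\<^sub>R (SUP i. r *\<^sub>R A i (\<phi> i))"
  proof (rule cSUP_least)
    fix i
    have "r *\<^sub>R A i (\<phi> i) \<le> (SUP i. r *\<^sub>R A i (\<phi> i))"
      by (intro cSUP_upper D_sequence_bdd_above[OF D_sequence_scaleR[OF assms]]) simp
    then have "inverse r *\<^sub>R (r *\<^sub>R A i (\<phi> i)) \<le> inverse r *\<^sub>R (SUP i. r *\<^sub>R A i (\<phi> i))"
      using assms(2) by (intro scaleR_left_mono) auto
    then show "A i (\<phi> i) \<le> inverse r *\<^sub>R (SUP i. r *\<^sub>R A i (\<phi> i))"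
      using assms(2) by simp
  qed simp
  then have "r *\<^sub>R (SUP i. A i (\<phi> i)) \<le> r *\<^sub>R (inverse r *\<^sub>R (SUP i. r *\<^sub>R A i (\<phi> i)))"
    using assms(2) by (intro scaleR_left_mono) auto
  then show ?thesis
    using assms(2) by simp
qed

text \<open>The form in which weak distributivity is applied: a common lower bound of all the
  suprema lies below their infimum.\<close>

lemma weakly_sigma_distributive_le_0:
  fixes A :: "nat \<Rightarrow> nat \<Rightarrow> 'a::dedekind_complete_riesz_space"
  assumes "weakly_sigma_distributive TYPE('a)" "D_sequence A"
    and "\<And>\<phi>. z \<le> (SUP i. A i (\<phi> i))"
  shows "z \<le> 0"
proof -
  have "z \<le> (INF \<phi>. SUP i. A i (\<phi> i))"
    by (intro cINF_greatest assms(3)) simp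
  then show ?thesis
    using assms(1,2) by (simp add: weakly_sigma_distributive_def)
qed

section \<open>Order limits of Cauchy sequences\<close>

lemma abs_diff_le_iff_lattice:
  fixes x y c :: "'a::lattice_ab_group_add_abs"
  shows "\<bar>x - y\<bar> \<le> c \<longleftrightarrow> x \<le> y + c \<and> y \<le> x + c"
  by (auto simp: abs_le_iff algebra_simps)

text \<open>The limit is the order limit inferior, the supremum of all eventual lower bounds. The
  Cauchy estimate makes \<open>x n - C \<phi>\<close> an eventual lower bound and keeps every
  eventual lower bound below \<open>x n + C \<phi>\<close>.\<close>

lemma Cauchy_limit_exists:
  fixes x :: "nat \<Rightarrow> 'a::dedekind_complete_riesz_space"
  assumes "\<And>\<phi>. \<exists>p. \<forall>n\<ge>p. \<forall>m\<ge>p. \<bar>x n - x m\<bar> \<le> C \<phi>"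
  shows "\<exists>l. \<forall>\<phi>. \<exists>p. \<forall>n\<ge>p. \<bar>x n - l\<bar> \<le> C \<phi>"
proof -
  \<comment> \<open>\<open>L\<close> does not mention \<open>\<phi>\<close>, so a single limit
    serves all \<open>\<phi>\<close>.\<close>
  define L where "L = {y. \<exists>p. \<forall>n\<ge>p. y \<le> x n}"
  have "\<exists>p. \<forall>n\<ge>p. \<bar>x n - Sup L\<bar> \<le> C \<phi>" for \<phi>
  proof -
    obtain p where p: "\<And>n m. n \<ge> p \<Longrightarrow> m \<ge> p \<Longrightarrow> x n \<le> x m + C \<phi>"
      using assms[of \<phi>] unfolding abs_diff_le_iff_lattice by blast
    have lower: "x n - C \<phi> \<in> L" if "n \<ge> p" for n
      using p[OF that] by (auto simp: L_def diff_le_eq)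
    have upper: "y \<le> x n + C \<phi>" if n: "n \<ge> p" and y: "y \<in> L" for n y
    proof -
      \<comment> \<open>The threshold \<open>q\<close> depends on \<open>y\<close>, whereas
        \<open>p\<close> does not; comparing at \<open>max p q\<close> removes \<open>q\<close> from
        the resulting bound.\<close>
      obtain q where "\<forall>m\<ge>q. y \<le> x m"
        using y by (auto simp: L_def)
      then have "y \<le> x (max p q)"
        by simp
      also have "\<dots> \<le> x n + C \<phi>"
        using n by (intro p) auto
      finally show ?thesis .
    qed
    have "\<bar>x n - Sup L\<bar> \<le> C \<phi>" if "n \<ge> p" for n
    proof -
      have "Sup L \<le> x n + C \<phi>"
        using lower[OF that] upper[OF that] by (intro cSup_least) auto
      moreover have "x n - C \<phi> \<le> Sup L"
        using lower[OF that] upper[OF that] by (intro cSup_upper bdd_aboveI) auto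
      ultimately show ?thesis
        by (simp add: abs_diff_le_iff_lattice diff_le_eq)
    qed
    then show ?thesis
      by blast
  qed
  then show ?thesis
    by blast
qed

section \<open>Cousin's lemma on time scales\<close>

lemma fine_HK_partition_snoc:
  assumes P: "fine_HK_partition T a s (\<delta>\<^sub>L, \<delta>\<^sub>R) (n, t, \<xi>)"
    and "s < u" "u \<in> T" "\<eta> \<in> T" "\<eta> \<in> {s..u}" "\<eta> - \<delta>\<^sub>L \<eta> \<le> s"
    and right: "\<And>w. w \<in> T \<Longrightarrow> s \<le> w \<Longrightarrow> w \<le> u \<Longrightarrow> w \<le> \<eta> + \<delta>\<^sub>R \<eta>"
  shows "fine_HK_partition T a u (\<delta>\<^sub>L, \<delta>\<^sub>R) (Suc n, t(Suc n := u), \<xi>(Suc n := \<eta>))"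
proof -
  have *: "\<forall>i\<in>{0..n}. t i \<in> T" "t 0 = a" "t n = s"
    "\<And>i. i \<in> {1..n} \<Longrightarrow> t (i - 1) < t i \<and> \<xi> i \<in> T \<inter> {t (i - 1)..t i} \<and>
        T \<inter> {t (i - 1)..t i} \<subseteq> {\<xi> i - \<delta>\<^sub>L (\<xi> i)..\<xi> i + \<delta>\<^sub>R (\<xi> i)}"
    using P by (auto simp: fine_HK_partition_def)
  define t' where "t' = t(Suc n := u)"
  define \<xi>' where "\<xi>' = \<xi>(Suc n := \<eta>)"
  have "t' (i - 1) < t' i \<and> \<xi>' i \<in> T \<inter> {t' (i - 1)..t' i} \<and>
        T \<inter> {t' (i - 1)..t' i} \<subseteq> {\<xi>' i - \<delta>\<^sub>L (\<xi>' i)..\<xi>' i + \<delta>\<^sub>R (\<xi>' i)}" if "i \<in> {1..Suc n}" for i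
  proof (cases "i = Suc n")
    case True
    then have "t' (i - 1) = s" "t' i = u" "\<xi>' i = \<eta>"
      using *(3) by (auto simp: t'_def \<xi>'_def)
    then show ?thesis
      using assms(2-6) right by (auto intro: order_trans)
  next
    case False
    then have "i \<in> {1..n}" "t' (i - 1) = t (i - 1)" "t' i = t i" "\<xi>' i = \<xi> i"
      using that by (auto simp: t'_def \<xi>'_def)
    then show ?thesis
      using *(4)[of i] by simp
  qed
  moreover have "\<forall>i\<in>{0..Suc n}. t' i \<in> T" "t' 0 = a" "t' (Suc n) = u"
    using *(1-3) assms(3) by (auto simp: t'_def)
  ultimately show ?thesis
    unfolding t'_def[symmetric] \<xi>'_def[symmetric] by (auto simp: fine_HK_partition_def)
qed

text \<open>Without this, a construction from left to right could stall at \<open>c\<close>. If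
  points of \<open>T\<close> accumulate at \<open>c\<close> from the right, positivity of
  \<open>\<delta>\<^sub>R c\<close> yields the next point; if there is a gap, the graininess bound
  lets the gauge reach across it.\<close>

lemma delta_gauge_next_point:
  assumes "closed T" "b \<in> T" "c \<in> T" "a \<le> c" "c < b" "delta_gauge T a b (\<delta>\<^sub>L, \<delta>\<^sub>R)"
  shows "\<exists>s\<in>T. c < s \<and> s \<le> b \<and> s \<le> c + \<delta>\<^sub>R c"
proof (cases "b \<le> c + \<delta>\<^sub>R c")
  case True
  then show ?thesis
    using assms by blast
next
  case False
  define U where "U = {s \<in> T. c < s}"
  have U: "U \<noteq> {}" "bdd_below U"
    using assms by (auto simp: U_def intro!: bdd_belowI[of _ c])
  have pos: "0 < \<delta>\<^sub>R c" and "graininess T c \<le> \<delta>\<^sub>R c"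
    using assms by (auto simp: delta_gauge_def)
  moreover have "forward_jump T c = Inf U"
    using assms by (auto simp: forward_jump_def U_def)
  ultimately have le: "Inf U \<le> c + \<delta>\<^sub>R c"
    by (simp add: graininess_def)
  show ?thesis
  proof (cases "Inf U < c + \<delta>\<^sub>R c")
    case True
    then obtain s where "s \<in> U" "s < c + \<delta>\<^sub>R c"
      using U cInf_less_iff by blast
    then show ?thesis
      using False by (intro bexI[of _ s]) (auto simp: U_def)
  next
    case eq: False
    \<comment> \<open>The gauge reaches exactly to the far side of the gap:
      \<open>Inf U = c + \<delta>\<^sub>R c\<close>, and positivity of
      \<open>\<delta>\<^sub>R c\<close> separates this point from \<open>c\<close>.\<close>
    have "Inf U \<in> T"
      using U assms(1) by (intro closed_subset_contains_Inf) (auto simp: U_def)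
    then show ?thesis
      using le eq pos False by (intro bexI[of _ "Inf U"]) auto
  qed
qed

text \<open>Cousin's argument. Let \<open>c\<close> be the supremum of the points up to which a fine
  partition exists; \<open>T\<close> being closed, \<open>c\<close> lies in \<open>T\<close>. An
  interval with its tag \<open>c\<close> at the right end reaches \<open>c\<close> itself, and if
  \<open>c < b\<close> another with its tag \<open>c\<close> at the left end would pass beyond
  it.\<close>

lemma fine_HK_partition_exists:
  assumes "closed T" "a \<in> T" "b \<in> T" "a < b" and gauge: "delta_gauge T a b \<delta>"
  shows "\<exists>P. fine_HK_partition T a b \<delta> P"
proof -
  obtain \<delta>\<^sub>L \<delta>\<^sub>R where \<delta>: "\<delta> = (\<delta>\<^sub>L, \<delta>\<^sub>R)"
    by (cases \<delta>)
  have gL: "0 < \<delta>\<^sub>L x" if "x \<in> T" "a < x" "x \<le> b" for x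
    using gauge that by (auto simp: \<delta> delta_gauge_def)
  have gR: "0 < \<delta>\<^sub>R x" if "x \<in> T" "a \<le> x" "x < b" for x
    using gauge that by (auto simp: \<delta> delta_gauge_def)
  \<comment> \<open>The endpoint conditions of a gauge extend nonnegativity to all of
    \<open>T \<inter> {a..b}\<close>; this admits a tag placed at an end of its own
    interval.\<close>
  have gL0: "0 \<le> \<delta>\<^sub>L x" if "x \<in> T" "a \<le> x" "x \<le> b" for x
    using gL[OF that(1) _ that(3)] gauge that(2)
    by (cases "x = a") (force simp: \<delta> delta_gauge_def)+
  have gR0: "0 \<le> \<delta>\<^sub>R x" if "x \<in> T" "a \<le> x" "x \<le> b" for x
    using gR[OF that(1,2)] gauge that(3)
    by (cases "x = b") (force simp: \<delta> delta_gauge_def)+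
  define S where "S = {s \<in> T \<inter> {a..b}. \<exists>P. fine_HK_partition T a s \<delta> P}"
  have S_step: "u \<in> S"
    if s: "s \<in> S" and that: "s < u" "u \<in> T" "u \<le> b" "\<eta> \<in> T" "\<eta> \<in> {s..u}" "\<eta> - \<delta>\<^sub>L \<eta> \<le> s" "u \<le> \<eta> + \<delta>\<^sub>R \<eta>"
    for s u \<eta>
  proof -
    obtain n t \<xi> where "fine_HK_partition T a s (\<delta>\<^sub>L, \<delta>\<^sub>R) (n, t, \<xi>)"
      using s by (auto simp: S_def \<delta>)
    from fine_HK_partition_snoc[OF this that(1,2,4,5,6)] show ?thesis
      using s that by (force simp: S_def \<delta>)
  qed
  \<comment> \<open>The empty partition, with \<open>n = 0\<close>, covers the degenerate interval
    and starts the construction.\<close>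
  have "fine_HK_partition T a a \<delta> (0, \<lambda>_. a, \<lambda>_. a)"
    using assms by (auto simp: fine_HK_partition_def \<delta>)
  then have aS: "a \<in> S"
    using assms by (auto simp: S_def)
  have bdd: "bdd_above S"
    by (auto simp: S_def)
  define c where "c = Sup S"
  have c_upper: "s \<le> c" if "s \<in> S" for s
    unfolding c_def using that bdd by (rule cSup_upper)
  have "c \<in> T \<inter> {a..b}"
    unfolding c_def using aS bdd assms(1)
    by (intro closed_subset_contains_Sup) (auto simp: S_def)
  then have c: "c \<in> T" "a \<le> c" "c \<le> b"
    by auto
  have cS: "c \<in> S"
  proof (cases "c = a")
    case False
    \<comment> \<open>Positivity of \<open>\<delta>\<^sub>L c\<close> leaves room below the supremum
      for a reachable \<open>s\<close> from which one interval tagged at \<open>c\<close>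
      suffices.\<close>
    then have "c - \<delta>\<^sub>L c < Sup S"
      using gL[of c] c by (simp add: c_def)
    then obtain s where s: "s \<in> S" "c - \<delta>\<^sub>L c < s"
      using less_cSup_iff[of S] aS bdd by blast
    show ?thesis
    proof (cases "s = c")
      case False
      then show ?thesis
        using s c c_upper[OF s(1)] gR0[of c] by (intro S_step[of s c c]) auto
    qed (use s in simp)
  qed (use aS in simp)
  have "c = b"
  proof (rule ccontr)
    assume "c \<noteq> b"
    then have "c < b"
      using c by simp
    then obtain s where s: "s \<in> T" "c < s" "s \<le> b" "s \<le> c + \<delta>\<^sub>R c"
      using delta_gauge_next_point[of T b c a] assms c \<delta> by blast
    then have "s \<in> S"
      using c cS gL0[of c] by (intro S_step[of c s c]) auto
    then show False
      using c_upper[of s] s by simp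
  qed
  then show ?thesis
    using cS by (auto simp: S_def)
qed

section \<open>Refinement of gauges and location of tags\<close>

lemma delta_gauge_min:
  assumes "delta_gauge T a b (\<delta>\<^sub>L, \<delta>\<^sub>R)" "delta_gauge T a b (\<delta>\<^sub>L', \<delta>\<^sub>R')"
  shows "delta_gauge T a b (\<lambda>x. min (\<delta>\<^sub>L x) (\<delta>\<^sub>L' x), \<lambda>x. min (\<delta>\<^sub>R x) (\<delta>\<^sub>R' x))"
  using assms by (auto simp: delta_gauge_def)

lemma fine_HK_partition_mono:
  assumes "fine_HK_partition T a b (\<delta>\<^sub>L, \<delta>\<^sub>R) P" "\<And>x. \<delta>\<^sub>L x \<le> \<delta>\<^sub>L' x" "\<And>x. \<delta>\<^sub>R x \<le> \<delta>\<^sub>R' x"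
  shows "fine_HK_partition T a b (\<delta>\<^sub>L', \<delta>\<^sub>R') P"
proof -
  obtain n t \<xi> where P: "P = (n, t, \<xi>)"
    by (cases P) auto
  have "T \<inter> {t (i - 1)..t i} \<subseteq> {\<xi> i - \<delta>\<^sub>L' (\<xi> i)..\<xi> i + \<delta>\<^sub>R' (\<xi> i)}" if "i \<in> {1..n}" for i
  proof -
    have "T \<inter> {t (i - 1)..t i} \<subseteq> {\<xi> i - \<delta>\<^sub>L (\<xi> i)..\<xi> i + \<delta>\<^sub>R (\<xi> i)}"
      using assms(1) that by (simp add: fine_HK_partition_def P)
    also have "\<dots> \<subseteq> {\<xi> i - \<delta>\<^sub>L' (\<xi> i)..\<xi> i + \<delta>\<^sub>R' (\<xi> i)}"
      using assms(2,3)[of "\<xi> i"] by auto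
    finally show ?thesis .
  qed
  then show ?thesis
    using assms(1) by (simp add: fine_HK_partition_def P)
qed

text \<open>The division points increase from \<open>a\<close> to \<open>b\<close>, which confines
  every tag to the interval where pointwise convergence is assumed.\<close>

lemma fine_HK_partition_tag:
  assumes P: "fine_HK_partition T a b \<delta> (n, t, \<xi>)" and "i \<in> {1..n}"
  shows "\<xi> i \<in> T \<inter> {a..b}"
proof -
  have *: "t 0 = a" "t n = b" "\<And>i. i \<in> {1..n} \<Longrightarrow> t (i - 1) < t i"
    "\<xi> i \<in> T \<inter> {t (i - 1)..t i}"
    using assms by (auto simp: fine_HK_partition_def split: prod.splits)
  have mono: "t j \<le> t k" if "j \<le> k" "k \<le> n" for j k
    using that
  proof (induction k rule: dec_induct)
    case (step k)
    then show ?case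
      using *(3)[of "Suc k"] by simp
  qed simp
  have "a \<le> t (i - 1)" "t i \<le> b"
    using mono[of 0 "i - 1"] mono[of i n] *(1,2) assms(2) by auto
  then show ?thesis
    using *(4) by auto
qed

section \<open>Riemann sums and the integral\<close>

lemma abs_scaleR_le:
  fixes x u :: "'a::dedekind_complete_riesz_space"
  assumes "\<bar>x\<bar> \<le> u" "0 \<le> r"
  shows "\<bar>r *\<^sub>R x\<bar> \<le> r *\<^sub>R u"
proof -
  have "r *\<^sub>R x \<le> r *\<^sub>R u" "r *\<^sub>R (- x) \<le> r *\<^sub>R u"
    using assms by (auto simp: abs_le_iff simp del: scaleR_minus_right intro!: scaleR_left_mono)
  then show ?thesis
    by (simp add: abs_le_iff)
qed

text \<open>The lengths of the intervals telescope to \<open>b - a\<close>, so the estimate does not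
  depend on the number or position of the division points.\<close>

lemma riemann_sum_diff_le:
  fixes g h :: "real \<Rightarrow> 'a::dedekind_complete_riesz_space"
  assumes P: "fine_HK_partition T a b \<delta> (n, t, \<xi>)"
    and "\<And>i. i \<in> {1..n} \<Longrightarrow> \<bar>g (\<xi> i) - h (\<xi> i)\<bar> \<le> u"
  shows "\<bar>riemann_sum g (n, t, \<xi>) - riemann_sum h (n, t, \<xi>)\<bar> \<le> (b - a) *\<^sub>R u"
proof -
  have *: "t 0 = a" "t n = b" "\<And>i. i \<in> {1..n} \<Longrightarrow> t (i - 1) < t i"
    using P by (auto simp: fine_HK_partition_def split: prod.splits)
  have "riemann_sum g (n, t, \<xi>) - riemann_sum h (n, t, \<xi>)
      = (\<Sum>i=1..n. (t i - t (i - 1)) *\<^sub>R (g (\<xi> i) - h (\<xi> i)))"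
    by (simp add: riemann_sum_def sum_subtractf scaleR_diff_right)
  also have "\<bar>\<dots>\<bar> \<le> (\<Sum>i=1..n. \<bar>(t i - t (i - 1)) *\<^sub>R (g (\<xi> i) - h (\<xi> i))\<bar>)"
    by (rule sum_abs)
  also have "\<dots> \<le> (\<Sum>i=1..n. (t i - t (i - 1)) *\<^sub>R u)"
    using *(3) assms(2) by (intro sum_mono abs_scaleR_le) (auto simp: less_imp_le)
  also have "\<dots> = (\<Sum>i=1..n. t i - t (i - 1)) *\<^sub>R u"
    by (simp add: scaleR_sum_left)
  also have "(\<Sum>i=1..n. t i - t (i - 1)) = b - a"
    using *(1,2) sum_telescope''[of 0 n t] by simp
  finally show ?thesis .
qed

text \<open>A partition fine for the minimum of two gauges is fine for both, so its Riemann sum is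
  close to \<open>x\<close> and to \<open>y\<close> at once. Weak distributivity then forces the
  distance of \<open>x\<close> and \<open>y\<close> to vanish.\<close>

lemma has_HK_integral_unique:
  fixes f :: "real \<Rightarrow> 'a::dedekind_complete_riesz_space"
  assumes "weakly_sigma_distributive TYPE('a)" "closed T" "a \<in> T" "b \<in> T" "a < b"
    and x: "has_HK_integral T a b f x" and y: "has_HK_integral T a b f y"
  shows "x = y"
proof -
  obtain A where A: "D_sequence A"
    "\<And>\<phi>. \<exists>\<delta>. delta_gauge T a b \<delta> \<and>
      (\<forall>P. fine_HK_partition T a b \<delta> P \<longrightarrow> \<bar>riemann_sum f P - x\<bar> < (SUP i. A i (\<phi> i)))"
    using x unfolding has_HK_integral_def by blast
  obtain B where B: "D_sequence B"
    "\<And>\<phi>. \<exists>\<delta>. delta_gauge T a b \<delta> \<and>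
      (\<forall>P. fine_HK_partition T a b \<delta> P \<longrightarrow> \<bar>riemann_sum f P - y\<bar> < (SUP i. B i (\<phi> i)))"
    using y unfolding has_HK_integral_def by blast
  have AB: "D_sequence (\<lambda>i j. A i j + B i j)"
    using A(1) B(1) by (rule D_sequence_add)
  have "\<bar>x - y\<bar> \<le> (SUP i. 2 *\<^sub>R (A i (\<phi> i) + B i (\<phi> i)))" for \<phi>
  proof -
    obtain \<delta>\<^sub>L \<delta>\<^sub>R where \<delta>: "delta_gauge T a b (\<delta>\<^sub>L, \<delta>\<^sub>R)"
      "\<And>P. fine_HK_partition T a b (\<delta>\<^sub>L, \<delta>\<^sub>R) P \<Longrightarrow> \<bar>riemann_sum f P - x\<bar> < (SUP i. A i (\<phi> i))"
      using A(2)[of \<phi>] by auto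
    obtain \<delta>\<^sub>L' \<delta>\<^sub>R' where \<delta>': "delta_gauge T a b (\<delta>\<^sub>L', \<delta>\<^sub>R')"
      "\<And>P. fine_HK_partition T a b (\<delta>\<^sub>L', \<delta>\<^sub>R') P \<Longrightarrow> \<bar>riemann_sum f P - y\<bar> < (SUP i. B i (\<phi> i))"
      using B(2)[of \<phi>] by auto
    obtain P where P: "fine_HK_partition T a b
        (\<lambda>x. min (\<delta>\<^sub>L x) (\<delta>\<^sub>L' x), \<lambda>x. min (\<delta>\<^sub>R x) (\<delta>\<^sub>R' x)) P"
      using fine_HK_partition_exists[OF assms(2-5) delta_gauge_min[OF \<delta>(1) \<delta>'(1)]] by blast
    have "\<bar>x - y\<bar> \<le> \<bar>riemann_sum f P - y\<bar> + \<bar>riemann_sum f P - x\<bar>"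
      using abs_triangle_ineq4[of "riemann_sum f P - y" "riemann_sum f P - x"] by simp
    also have "\<dots> \<le> (SUP i. B i (\<phi> i)) + (SUP i. A i (\<phi> i))"
      by (intro add_mono less_imp_le[OF \<delta>(2)] less_imp_le[OF \<delta>'(2)]
          fine_HK_partition_mono[OF P]) auto
    \<comment> \<open>Passing to the summed regulator expresses both errors by one supremum along
      the same \<open>\<phi>\<close>; the factor 2 then moves inside.\<close>
    also have "\<dots> \<le> (SUP i. A i (\<phi> i) + B i (\<phi> i)) + (SUP i. A i (\<phi> i) + B i (\<phi> i))"
      by (intro add_mono SUP_D_sequence_le_add A B)
    also have "\<dots> = 2 *\<^sub>R (SUP i. A i (\<phi> i) + B i (\<phi> i))"
      by (simp add: scaleR_2)
    also have "\<dots> \<le> (SUP i. 2 *\<^sub>R (A i (\<phi> i) + B i (\<phi> i)))"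
      using SUP_scaleR_D_sequence_ge[OF AB] by simp
    finally show ?thesis .
  qed
  moreover have "D_sequence (\<lambda>i j. 2 *\<^sub>R (A i j + B i j))"
    using AB by (rule D_sequence_scaleR) simp
  ultimately have "\<bar>x - y\<bar> \<le> 0"
    using assms(1) weakly_sigma_distributive_le_0 by blast
  then show ?thesis
    by simp
qed

lemma HK_integral_eqI:
  fixes f :: "real \<Rightarrow> 'a::dedekind_complete_riesz_space"
  assumes "weakly_sigma_distributive TYPE('a)" "closed T" "a \<in> T" "b \<in> T" "a < b"
    and "has_HK_integral T a b f x"
  shows "HK_integral T a b f = x"
  unfolding HK_integral_def using assms has_HK_integral_unique by (intro the_equality) blast+

section \<open>Passage to the limit under the integral for uniformly integrable sequences\<close>

theorem theorem4p3:
  fixes T :: "real set" and a b :: real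
    and f :: "real \<Rightarrow> 'a::dedekind_complete_riesz_space"
    and fn :: "nat \<Rightarrow> real \<Rightarrow> 'a"
  assumes "weakly_sigma_distributive TYPE('a)"
    and "time_scale T" and "a \<in> T" and "b \<in> T" and "a < b"
    and "uniformly_HK_integrable T a b fn"
    and "converges_common_regulator T a b fn f"
  shows "HK_integrable T a b f \<and>
         D_limit (\<lambda>n. HK_integral T a b (fn n)) (HK_integral T a b f)"
proof -
  have T: "closed T"
    using assms(2) by (simp add: time_scale_def)
  define I where "I n = HK_integral T a b (fn n)" for n
  obtain A where A: "D_sequence A"
    "\<And>\<phi> t. t \<in> T \<inter> {a..b} \<Longrightarrow> \<exists>p. \<forall>n\<ge>p. \<bar>fn n t - f t\<bar> < (SUP i. A i (\<phi> i))"
    using assms(7) unfolding converges_common_regulator_def by blast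
  obtain B where B: "D_sequence B"
    "\<And>\<phi>. \<exists>\<delta>. delta_gauge T a b \<delta> \<and> (\<forall>P. fine_HK_partition T a b \<delta> P \<longrightarrow>
        (\<forall>n. \<bar>riemann_sum (fn n) P - I n\<bar> < (SUP i. B i (\<phi> i))))"
    using assms(6) unfolding uniformly_HK_integrable_def I_def by blast
  \<comment> \<open>\<open>E \<phi>\<close> is the common unit of error: it dominates both the
    pointwise and the integration error, and all later estimates are multiples of it.\<close>
  define E where "E \<phi> = (SUP i. A i (\<phi> i) + B i (\<phi> i))" for \<phi>
  have AB: "D_sequence (\<lambda>i j. A i j + B i j)"
    using A(1) B(1) by (rule D_sequence_add)
  define r where "r = b - a"
  have r: "0 < r"
    using assms(5) by (simp add: r_def)
  have AE: "\<exists>p. \<forall>n\<ge>p. \<bar>fn n t - f t\<bar> \<le> E \<phi>" if "t \<in> T \<inter> {a..b}" for \<phi> t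
    using A(2)[OF that, of \<phi>] SUP_D_sequence_le_add(1)[OF A(1) B(1), of \<phi>]
    unfolding E_def by (meson less_imp_le order_trans)
  have BE: "\<exists>\<delta>. delta_gauge T a b \<delta> \<and> (\<forall>P. fine_HK_partition T a b \<delta> P \<longrightarrow>
        (\<forall>n. \<bar>riemann_sum (fn n) P - I n\<bar> < E \<phi>))" for \<phi>
    using B(2)[of \<phi>] SUP_D_sequence_le_add(2)[OF A(1) B(1), of \<phi>]
    unfolding E_def by (meson less_le_trans)
  have sums: "\<exists>p. \<forall>n\<ge>p. \<bar>riemann_sum (fn n) P - riemann_sum f P\<bar> \<le> r *\<^sub>R E \<phi>"
    if P: "fine_HK_partition T a b \<delta> P" for \<delta> P \<phi>
  proof -
    obtain m t \<xi> where P_eq: "P = (m, t, \<xi>)"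
      by (cases P) auto
    have "\<forall>i\<in>{1..m}. \<exists>p. \<forall>n\<ge>p. \<bar>fn n (\<xi> i) - f (\<xi> i)\<bar> \<le> E \<phi>"
      using AE fine_HK_partition_tag[OF P[unfolded P_eq]] by blast
    \<comment> \<open>A partition has only finitely many tags, so their separate thresholds have a
      common one. It depends on \<open>P\<close>.\<close>
    then have "eventually (\<lambda>n. \<forall>i\<in>{1..m}. \<bar>fn n (\<xi> i) - f (\<xi> i)\<bar> \<le> E \<phi>) sequentially"
      by (intro eventually_ball_finite) (auto simp: eventually_sequentially)
    then show ?thesis
      using riemann_sum_diff_le[OF P[unfolded P_eq]]
      unfolding P_eq r_def eventually_sequentially by blast
  qed
  \<comment> \<open>The share \<open>r\<close> comes from exchanging \<open>f\<close> for
    \<open>fn n\<close> at the tags, the share 1 from uniform integrability.\<close>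
  have near: "\<exists>p. \<forall>n\<ge>p. \<bar>riemann_sum f P - I n\<bar> \<le> (r + 1) *\<^sub>R E \<phi>"
    if P: "fine_HK_partition T a b \<delta> P" and "\<And>n. \<bar>riemann_sum (fn n) P - I n\<bar> < E \<phi>" for \<delta> P \<phi>
  proof -
    obtain p where p: "\<And>n. n \<ge> p \<Longrightarrow> \<bar>riemann_sum (fn n) P - riemann_sum f P\<bar> \<le> r *\<^sub>R E \<phi>"
      using sums[OF P, of \<phi>] by blast
    have "\<bar>riemann_sum f P - I n\<bar> \<le> (r + 1) *\<^sub>R E \<phi>" if "n \<ge> p" for n
    proof -
      have "\<bar>riemann_sum f P - I n\<bar>
          \<le> \<bar>riemann_sum f P - riemann_sum (fn n) P\<bar> + \<bar>riemann_sum (fn n) P - I n\<bar>"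
        using abs_triangle_ineq[of "riemann_sum f P - riemann_sum (fn n) P"
            "riemann_sum (fn n) P - I n"] by simp
      also have "\<dots> \<le> r *\<^sub>R E \<phi> + E \<phi>"
        using p[OF that] \<open>\<bar>riemann_sum (fn n) P - I n\<bar> < E \<phi>\<close>
        by (intro add_mono) (auto simp: abs_minus_commute)
      finally show ?thesis
        by (simp add: scaleR_left_distrib)
    qed
    then show ?thesis
      by blast
  qed
  have E_pos: "0 < E \<phi>" and Cauchy: "\<exists>p. \<forall>n\<ge>p. \<forall>m\<ge>p. \<bar>I n - I m\<bar> \<le> (2 * (r + 1)) *\<^sub>R E \<phi>" for \<phi>
  proof -
    obtain \<delta> where \<delta>: "delta_gauge T a b \<delta>"
      "\<And>P n. fine_HK_partition T a b \<delta> P \<Longrightarrow> \<bar>riemann_sum (fn n) P - I n\<bar> < E \<phi>"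
      using BE[of \<phi>] by blast
    obtain P where P: "fine_HK_partition T a b \<delta> P"
      using fine_HK_partition_exists[OF T assms(3-5) \<delta>(1)] by blast
    \<comment> \<open>Strictness in the gauge estimate, together with the existence of a fine
      partition, makes \<open>E \<phi>\<close> strictly positive.\<close>
    show "0 < E \<phi>"
      using \<delta>(2)[OF P, of 0] abs_ge_zero by (rule le_less_trans[rotated])
    obtain p where p: "\<And>n. n \<ge> p \<Longrightarrow> \<bar>riemann_sum f P - I n\<bar> \<le> (r + 1) *\<^sub>R E \<phi>"
      using near[OF P, of \<phi>] \<delta>(2)[OF P] by blast
    \<comment> \<open>One gauge serves all \<open>n\<close>, so a single partition compares any two
      late integrals; each comparison costs \<open>r + 1\<close>.\<close>
    have "\<bar>I n - I m\<bar> \<le> (2 * (r + 1)) *\<^sub>R E \<phi>" if "n \<ge> p" "m \<ge> p" for n m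
    proof -
      have "\<bar>I n - I m\<bar> \<le> \<bar>riemann_sum f P - I m\<bar> + \<bar>riemann_sum f P - I n\<bar>"
        using abs_triangle_ineq4[of "riemann_sum f P - I m" "riemann_sum f P - I n"] by simp
      also have "\<dots> \<le> (r + 1) *\<^sub>R E \<phi> + (r + 1) *\<^sub>R E \<phi>"
        using that by (intro add_mono p)
      also have "\<dots> = (2 * (r + 1)) *\<^sub>R E \<phi>"
        by (simp only: mult_2 scaleR_left_distrib)
      finally show ?thesis .
    qed
    then show "\<exists>p. \<forall>n\<ge>p. \<forall>m\<ge>p. \<bar>I n - I m\<bar> \<le> (2 * (r + 1)) *\<^sub>R E \<phi>"
      by blast
  qed
  obtain l where l: "\<And>\<phi>. \<exists>p. \<forall>n\<ge>p. \<bar>I n - l\<bar> \<le> (2 * (r + 1)) *\<^sub>R E \<phi>"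
    using Cauchy_limit_exists[of I "\<lambda>\<phi>. (2 * (r + 1)) *\<^sub>R E \<phi>"] Cauchy by blast
  \<comment> \<open>The errors add up to \<open>(r + 1) + 2 * (r + 1) = 3 * (r + 1)\<close>. The
    larger factor 4 leaves a positive multiple of \<open>E \<phi>\<close> in reserve, which yields
    the strict inequality required of an integral.\<close>
  have k: "0 < 4 * (r + 1)"
    using r by simp
  have D: "D_sequence (\<lambda>i j. (4 * (r + 1)) *\<^sub>R (A i j + B i j))"
    using AB k by (rule D_sequence_scaleR)
  have E_le: "(4 * (r + 1)) *\<^sub>R E \<phi> \<le> (SUP i. (4 * (r + 1)) *\<^sub>R (A i (\<phi> i) + B i (\<phi> i)))" for \<phi>
    unfolding E_def using SUP_scaleR_D_sequence_ge[OF AB k] .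
  have scale: "s *\<^sub>R E \<phi> < (SUP i. (4 * (r + 1)) *\<^sub>R (A i (\<phi> i) + B i (\<phi> i)))"
    if "s < 4 * (r + 1)" for s \<phi>
  proof -
    have "0 < (4 * (r + 1) - s) *\<^sub>R E \<phi>"
      using that E_pos[of \<phi>] by (auto simp: less_le intro: scaleR_nonneg_nonneg)
    then have "s *\<^sub>R E \<phi> < (4 * (r + 1)) *\<^sub>R E \<phi>"
      by (simp only: scaleR_left_diff_distrib less_diff_eq add_0)
    then show ?thesis
      using E_le less_le_trans by blast
  qed
  have integral: "has_HK_integral T a b f l"
    unfolding has_HK_integral_def
  proof (intro exI[of _ "\<lambda>i j. (4 * (r + 1)) *\<^sub>R (A i j + B i j)"] conjI allI D)
    fix \<phi>
    obtain \<delta> where \<delta>: "delta_gauge T a b \<delta>"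
      "\<And>P n. fine_HK_partition T a b \<delta> P \<Longrightarrow> \<bar>riemann_sum (fn n) P - I n\<bar> < E \<phi>"
      using BE[of \<phi>] by blast
    have "\<bar>riemann_sum f P - l\<bar> < (SUP i. (4 * (r + 1)) *\<^sub>R (A i (\<phi> i) + B i (\<phi> i)))"
      if P: "fine_HK_partition T a b \<delta> P" for P
    proof -
      obtain p where p: "\<And>n. n \<ge> p \<Longrightarrow> \<bar>riemann_sum f P - I n\<bar> \<le> (r + 1) *\<^sub>R E \<phi>"
        using near[OF P, of \<phi>] \<delta>(2)[OF P] by blast
      obtain q where q: "\<And>n. n \<ge> q \<Longrightarrow> \<bar>I n - l\<bar> \<le> (2 * (r + 1)) *\<^sub>R E \<phi>"
        using l[of \<phi>] by blast
      \<comment> \<open>The index may depend on \<open>P\<close>, since the final bound no longer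
        contains \<open>n\<close>.\<close>
      define n where "n = max p q"
      have "\<bar>riemann_sum f P - l\<bar> \<le> \<bar>riemann_sum f P - I n\<bar> + \<bar>I n - l\<bar>"
        using abs_triangle_ineq[of "riemann_sum f P - I n" "I n - l"] by simp
      also have "\<dots> \<le> (r + 1) *\<^sub>R E \<phi> + (2 * (r + 1)) *\<^sub>R E \<phi>"
        by (intro add_mono p q) (auto simp: n_def)
      also have "\<dots> = (3 * (r + 1)) *\<^sub>R E \<phi>"
        by (simp add: algebra_simps flip: scaleR_left_distrib)
      also have "\<dots> < (SUP i. (4 * (r + 1)) *\<^sub>R (A i (\<phi> i) + B i (\<phi> i)))"
        using r by (intro scale) simp
      finally show ?thesis .
    qed
    then show "\<exists>\<delta>. delta_gauge T a b \<delta> \<and> (\<forall>P. fine_HK_partition T a b \<delta> P \<longrightarrow>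
        \<bar>riemann_sum f P - l\<bar> < (SUP i. (4 * (r + 1)) *\<^sub>R (A i (\<phi> i) + B i (\<phi> i))))"
      using \<delta>(1) by blast
  qed
  \<comment> \<open>The regulator chosen for the integral also witnesses the limit, as
    \<open>2 * (r + 1)\<close> is below its factor.\<close>
  have "\<exists>p. \<forall>n\<ge>p. \<bar>I n - l\<bar> \<le> (SUP i. (4 * (r + 1)) *\<^sub>R (A i (\<phi> i) + B i (\<phi> i)))" for \<phi>
    using l[of \<phi>] scale[of "2 * (r + 1)" \<phi>] r by (auto dest: less_imp_le intro: order_trans)
  then have "D_limit I l"
    unfolding D_limit_def using D by (intro exI[of _ "\<lambda>i j. (4 * (r + 1)) *\<^sub>R (A i j + B i j)"]) blast
  moreover have "HK_integral T a b f = l"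
    using HK_integral_eqI[OF assms(1) T assms(3-5) integral] .
  ultimately show ?thesis
    using integral unfolding HK_integrable_def I_def by blast
qed

end
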